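(* For all $a,b,c,d\in\mathbb{R}$, $$\exp[a,a,b,c]\,\exp[d,d,b,c]+\exp[b,b,a,d]\,\exp[c,c,a,d]-\exp[a,b,c,d]^2\ \ge\ 0.$$
   Context: $\exp[z_0,\dots,z_m]$ denotes the divided difference of the function $e^x$ at the nodes $z_0,\dots,z_m$. It is symmetric in the nodes; for pairwise distinct nodes it equals $\sum_{i=0}^m e^{z_i}/\prod_{j\ne i}(z_i-z_j)$, and for repeated nodes it is defined by continuous extension, equivalently by the contour integral $\frac{1}{2\pi i}\oint_\Gamma \frac{e^z}{\prod_{i=0}^m (z-z_i)}\,dz$ with $\Gamma$ a positively oriented contour enclosing all nodes. *)

theory Defs
  imports "HOL-Complex_Analysis.Complex_Analysis"
begin

(* Divided difference of exp at the nodes zs (repetitions allowed), as a contour integral.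
   The circle about 0 encloses all nodes; its choice is immaterial
   (exp_dd_complex_eq_contour_integral). The value is symmetric in the nodes (exp_dd_cong_mset)
   and is the continuous extension (tendsto_exp_dd) of the explicit sum for pairwise distinct
   nodes (exp_dd_distinct). *)
definition exp_dd_complex :: "complex list \<Rightarrow> complex" where
  "exp_dd_complex zs =
     contour_integral (circlepath 0 (1 + (\<Sum>w\<leftarrow>zs. norm w)))
       (\<lambda>z. exp z / (\<Prod>w\<leftarrow>zs. z - w)) / (2 * of_real pi * \<i>)"

(* For real nodes the contour integral has a real value (of_real_exp_dd below),
   so taking the real part discards nothing. *)
definition exp_dd :: "real list \<Rightarrow> real" where
  "exp_dd xs = Re (exp_dd_complex (map of_real xs))"

lemma norm_le_sum_list_norm: "w \<in> set zs \<Longrightarrow> norm w \<le> (\<Sum>u\<leftarrow>zs. norm u)"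
  for zs :: "complex list"
  by (rule member_le_sum_list) auto

lemma sum_list_norm_nonneg: "0 \<le> (\<Sum>u\<leftarrow>zs. norm u)" for zs :: "complex list"
  by (rule sum_list_nonneg) auto

lemma prod_list_diff_eq_0_iff: "(\<Prod>w\<leftarrow>zs. z - w) = 0 \<longleftrightarrow> z \<in> set zs"
  for z :: complex
  by (induction zs) auto

lemma holomorphic_prod_list_diff: "(\<lambda>z. \<Prod>w\<leftarrow>zs. z - w) holomorphic_on A"
  for zs :: "complex list"
  by (induction zs) (auto intro!: holomorphic_intros)

lemma contour_integral_exp_dd_residues:
  assumes "valid_path g" "pathfinish g = pathstart g"
    and "path_image g \<inter> set zs = {}"
    and "\<And>w. w \<in> set zs \<Longrightarrow> winding_number g w = 1"
  shows "contour_integral g (\<lambda>z. exp z / (\<Prod>w\<leftarrow>zs. z - w)) =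
    2 * of_real pi * \<i> * (\<Sum>p\<in>set zs. residue (\<lambda>z. exp z / (\<Prod>w\<leftarrow>zs. z - w)) p)"
proof -
  have "(\<lambda>z. exp z / (\<Prod>w\<leftarrow>zs. z - w)) holomorphic_on UNIV - set zs"
    by (auto intro!: holomorphic_intros holomorphic_prod_list_diff simp: prod_list_diff_eq_0_iff)
  then have "contour_integral g (\<lambda>z. exp z / (\<Prod>w\<leftarrow>zs. z - w)) =
    2 * of_real pi * \<i> * (\<Sum>p\<in>set zs. winding_number g p * residue (\<lambda>z. exp z / (\<Prod>w\<leftarrow>zs. z - w)) p)"
    using assms Residue_theorem[of UNIV "set zs" _ g] by (simp add: Diff_eq disjoint_eq_subset_Compl connected_UNIV)
  then show ?thesis
    using assms(4) by simp
qed

lemma contour_integral_circlepath_residues: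
  assumes "0 < R" "\<And>w. w \<in> set zs \<Longrightarrow> norm w < R"
  shows "contour_integral (circlepath 0 R) (\<lambda>z. exp z / (\<Prod>w\<leftarrow>zs. z - w)) =
    2 * of_real pi * \<i> * (\<Sum>p\<in>set zs. residue (\<lambda>z. exp z / (\<Prod>w\<leftarrow>zs. z - w)) p)"
proof (rule contour_integral_exp_dd_residues)
  have "w \<notin> path_image (circlepath 0 R)" if "w \<in> set zs" for w
    using assms(1) assms(2)[OF that] by simp
  then show "path_image (circlepath 0 R) \<inter> set zs = {}"
    by blast
  show "winding_number (circlepath 0 R) w = 1" if "w \<in> set zs" for w
    using assms(2)[OF that] by (intro winding_number_circlepath) simp
qed simp_all

lemma exp_dd_complex_residues:
  "exp_dd_complex zs = (\<Sum>p\<in>set zs. residue (\<lambda>z. exp z / (\<Prod>w\<leftarrow>zs. z - w)) p)"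
proof -
  have "0 < 1 + (\<Sum>w\<leftarrow>zs. norm w)"
    using sum_list_norm_nonneg[of zs] by linarith
  moreover have "norm w < 1 + (\<Sum>w\<leftarrow>zs. norm w)" if "w \<in> set zs" for w
    using norm_le_sum_list_norm[OF that] by linarith
  ultimately show ?thesis
    unfolding exp_dd_complex_def by (subst contour_integral_circlepath_residues) simp_all
qed

lemma exp_dd_complex_eq_contour_integral:
  assumes "valid_path g" "pathfinish g = pathstart g"
    and "path_image g \<inter> set zs = {}"
    and "\<And>w. w \<in> set zs \<Longrightarrow> winding_number g w = 1"
  shows "exp_dd_complex zs =
    contour_integral g (\<lambda>z. exp z / (\<Prod>w\<leftarrow>zs. z - w)) / (2 * of_real pi * \<i>)"
  using contour_integral_exp_dd_residues[OF assms] by (simp add: exp_dd_complex_residues)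

lemma exp_dd_complex_eq_circlepath:
  assumes "0 < R" "\<And>w. w \<in> set zs \<Longrightarrow> norm w < R"
  shows "exp_dd_complex zs =
    contour_integral (circlepath 0 R) (\<lambda>z. exp z / (\<Prod>w\<leftarrow>zs. z - w)) / (2 * of_real pi * \<i>)"
  using contour_integral_circlepath_residues[OF assms] by (simp add: exp_dd_complex_residues)

lemma exp_dd_complex_cong_mset:
  assumes "mset zs = mset ws"
  shows "exp_dd_complex zs = exp_dd_complex ws"
proof -
  have "(\<Prod>w\<leftarrow>zs. z - w) = (\<Prod>w\<leftarrow>ws. z - w)" for z :: complex
    using arg_cong[OF assms, of "\<lambda>M. \<Prod>w\<in>#M. z - w"] by (simp flip: mset_map add: prod_mset_prod_list)
  then show ?thesis
    using mset_eq_setD[OF assms] by (simp add: exp_dd_complex_residues)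
qed

lemma exp_dd_cong_mset:
  assumes "mset xs = mset ys"
  shows "exp_dd xs = exp_dd ys"
proof -
  have "mset (map complex_of_real xs) = mset (map of_real ys)"
    using assms by simp
  then show ?thesis
    unfolding exp_dd_def by (rule arg_cong[OF exp_dd_complex_cong_mset])
qed

lemma cnj_exp_dd_complex_of_real:
  "cnj (exp_dd_complex (map of_real xs)) = exp_dd_complex (map of_real xs)"
proof -
  let ?R = "1 + (\<Sum>w\<leftarrow>map complex_of_real xs. norm w)"
  let ?f = "\<lambda>z. exp z / (\<Prod>w\<leftarrow>map complex_of_real xs. z - w)"
  have f: "cnj \<circ> ?f \<circ> cnj = ?f"
  proof
    have "cnj (\<Prod>w\<leftarrow>map complex_of_real xs. cnj z - w) = (\<Prod>w\<leftarrow>map complex_of_real xs. z - w)" for z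
      by (induction xs) auto
    then show "(cnj \<circ> ?f \<circ> cnj) z = ?f z" for z
      by (simp add: exp_cnj)
  qed
  have g: "cnj \<circ> circlepath 0 ?R = reversepath (circlepath 0 ?R)"
  proof
    have "exp (2 * of_real pi * \<i> * (1 - of_real t)) = exp (- (2 * of_real pi * \<i> * of_real t))" for t
      by (simp add: right_diff_distrib exp_diff exp_minus divide_inverse)
    then show "(cnj \<circ> circlepath 0 ?R) t = reversepath (circlepath 0 ?R) t" for t
      by (simp add: circlepath reversepath_def exp_cnj)
  qed
  have "cnj (contour_integral (circlepath 0 ?R) ?f) = contour_integral (cnj \<circ> circlepath 0 ?R) ?f"
    by (simp only: contour_integral_cnj valid_path_circlepath f)
  also have "\<dots> = - contour_integral (circlepath 0 ?R) ?f"
    unfolding g by (rule contour_integral_reversepath) simp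
  finally show ?thesis
    by (simp add: exp_dd_complex_def)
qed

lemma of_real_exp_dd: "of_real (exp_dd xs) = exp_dd_complex (map of_real xs)"
  using cnj_exp_dd_complex_of_real[of xs]
  by (simp add: exp_dd_def complex_eq_iff)

lemma exp_dd_complex_distinct:
  assumes "distinct zs"
  shows "exp_dd_complex zs = (\<Sum>w\<in>set zs. exp w / (\<Prod>v\<in>set zs - {w}. w - v))"
  unfolding exp_dd_complex_residues
proof (rule sum.cong)
  fix p assume p: "p \<in> set zs"
  let ?h = "\<lambda>z. exp z / (\<Prod>v\<in>set zs - {p}. z - v)"
  have "(\<Prod>w\<leftarrow>zs. z - w) = (\<Prod>v\<in>set zs - {p}. z - v) * (z - p)" for z
    using prod.remove[of "set zs" p "\<lambda>w. z - w"] prod.distinct_set_conv_list[OF assms, of "\<lambda>w. z - w"] p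
    by (simp add: mult.commute)
  then have eq: "(\<lambda>z. exp z / (\<Prod>w\<leftarrow>zs. z - w)) = (\<lambda>z. ?h z / (z - p))"
    by simp
  have hol: "?h holomorphic_on - (set zs - {p})"
    by (intro holomorphic_intros) auto
  have "open (- (set zs - {p}))"
    by (intro open_Compl finite_imp_closed) simp
  then show "residue (\<lambda>z. exp z / (\<Prod>w\<leftarrow>zs. z - w)) p = ?h p"
    unfolding eq by (rule residue_simple[OF _ _ hol]) simp
qed simp

lemma exp_dd_distinct:
  assumes "distinct xs"
  shows "exp_dd xs = (\<Sum>x\<in>set xs. exp x / (\<Prod>y\<in>set xs - {x}. x - y))"
proof -
  have inj: "inj_on complex_of_real A" for A
    by (simp add: inj_on_def)
  have img: "set (map complex_of_real xs) - {of_real x} = of_real ` (set xs - {x})" for x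
    by auto
  have "complex_of_real (exp_dd xs) = exp_dd_complex (map of_real xs)"
    by (rule of_real_exp_dd)
  also have "\<dots> = (\<Sum>w\<in>complex_of_real ` set xs.
      exp w / (\<Prod>v\<in>set (map complex_of_real xs) - {w}. w - v))"
    using assms inj by (subst exp_dd_complex_distinct) (auto simp: distinct_map)
  also have "\<dots> = (\<Sum>x\<in>set xs. exp (of_real x) / (\<Prod>y\<in>set xs - {x}. of_real x - of_real y))"
    unfolding sum.reindex[OF inj] o_def img prod.reindex[OF inj] ..
  also have "\<dots> = of_real (\<Sum>x\<in>set xs. exp x / (\<Prod>y\<in>set xs - {x}. x - y))"
    by (simp add: exp_of_real)
  finally show ?thesis
    by (simp only: of_real_eq_iff)
qed

lemma tendsto_exp_dd_complex:
  fixes Z :: "'i \<Rightarrow> 'n \<Rightarrow> complex"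
  assumes lim: "\<And>i. i \<in> set ks \<Longrightarrow> (Z i \<longlongrightarrow> z i) F"
  shows "((\<lambda>n. exp_dd_complex (map (\<lambda>i. Z i n) ks)) \<longlongrightarrow> exp_dd_complex (map z ks)) F"
proof (cases "F = bot")
  case False
  define R where "R = 1 + (\<Sum>w\<leftarrow>map z ks. norm w)"
  have R: "0 < R"
    using sum_list_norm_nonneg[of "map z ks"] by (simp add: R_def)
  have zR: "norm (z i) < R" if "i \<in> set ks" for i
    using norm_le_sum_list_norm[of "z i" "map z ks"] that by (auto simp: R_def)
  have ZR: "\<forall>\<^sub>F n in F. \<forall>i\<in>set ks. norm (Z i n) < R"
    using zR by (intro eventually_ball_finite ballI order_tendstoD(2)[OF tendsto_norm[OF lim]]) auto
  have cont: "continuous_on A (\<lambda>u. \<Prod>i\<leftarrow>js. u - c i)" for A and js :: "'i list" and c :: "'i \<Rightarrow> complex"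
    by (induction js) (auto intro!: continuous_intros)
  have bdd: "bounded ((\<lambda>u. \<Prod>i\<leftarrow>js. u - z i) ` sphere 0 R)" for js
    by (intro compact_imp_bounded compact_continuous_image cont) auto
  have prod: "uniform_limit (sphere 0 R) (\<lambda>n u. \<Prod>i\<leftarrow>js. u - Z i n) (\<lambda>u. \<Prod>i\<leftarrow>js. u - z i) F"
    if "set js \<subseteq> set ks" for js
    using that
  proof (induction js)
    case Nil
    then show ?case
      by (simp add: uniform_limit_const)
  next
    case (Cons i js)
    have "uniform_limit (sphere 0 R) (\<lambda>n u. u - Z i n) (\<lambda>u. u - z i) F"
      using lim[of i] Cons.prems
      by (auto simp: uniform_limit_iff tendsto_iff dist_norm norm_minus_commute)
    moreover have "bounded ((\<lambda>u. u - z i) ` sphere 0 R)"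
      by (intro compact_imp_bounded compact_continuous_image continuous_intros) auto
    ultimately show ?case
      using Cons bdd by (auto intro!: uniform_lim_mult)
  qed
  have nz: "(\<Prod>i\<leftarrow>ks. u - z i) \<noteq> 0" if "u \<in> sphere 0 R" for u
    using prod_list_diff_eq_0_iff[of u "map z ks"] zR that by (force simp: o_def)
  have "compact ((\<lambda>u. norm (\<Prod>i\<leftarrow>ks. u - z i)) ` sphere 0 R)"
    by (intro compact_continuous_image continuous_intros cont) auto
  then obtain u0 where u0: "u0 \<in> sphere 0 R"
    "\<And>u. u \<in> sphere 0 R \<Longrightarrow> norm (\<Prod>i\<leftarrow>ks. u0 - z i) \<le> norm (\<Prod>i\<leftarrow>ks. u - z i)"
    using R continuous_attains_inf[of "sphere 0 R" "\<lambda>u. norm (\<Prod>i\<leftarrow>ks. u - z i)"]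
    by (force intro!: continuous_intros cont)
  have lim': "uniform_limit (sphere 0 R) (\<lambda>n u. exp u / (\<Prod>i\<leftarrow>ks. u - Z i n))
      (\<lambda>u. exp u / (\<Prod>i\<leftarrow>ks. u - z i)) F"
  proof (rule uniform_lim_divide)
    show "bounded (exp ` sphere (0::complex) R)"
      by (intro compact_imp_bounded compact_continuous_image continuous_intros) auto
    show "0 < norm (\<Prod>i\<leftarrow>ks. u0 - z i)"
      using nz u0(1) by simp
  qed (use prod u0(2) in \<open>auto simp: uniform_limit_const\<close>)
  have int: "(\<lambda>u. exp u / (\<Prod>i\<leftarrow>ks. u - c i)) contour_integrable_on circlepath 0 R"
    if "\<forall>i\<in>set ks. norm (c i) < R" for c :: "'i \<Rightarrow> complex"
  proof (intro contour_integrable_continuous_circlepath continuous_intros cont ballI)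
    fix u assume "u \<in> path_image (circlepath 0 R)"
    then show "(\<Prod>i\<leftarrow>ks. u - c i) \<noteq> 0"
      using prod_list_diff_eq_0_iff[of u "map c ks"] that R by (force simp: o_def)
  qed
  have lim'': "((\<lambda>n. contour_integral (circlepath 0 R) (\<lambda>u. exp u / (\<Prod>i\<leftarrow>ks. u - Z i n))) \<longlongrightarrow>
      contour_integral (circlepath 0 R) (\<lambda>u. exp u / (\<Prod>i\<leftarrow>ks. u - z i))) F"
    using R False lim' ZR
    by (intro contour_integral_uniform_limit_circlepath(2)) (auto elim!: eventually_mono intro: int)
  have eq: "exp_dd_complex (map c ks) =
      contour_integral (circlepath 0 R) (\<lambda>u. exp u / (\<Prod>i\<leftarrow>ks. u - c i)) / (2 * of_real pi * \<i>)"
    if "\<forall>i\<in>set ks. norm (c i) < R" for c :: "'i \<Rightarrow> complex"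
    using R that by (subst exp_dd_complex_eq_circlepath[of R]) (auto simp: o_def)
  have "((\<lambda>n. contour_integral (circlepath 0 R) (\<lambda>u. exp u / (\<Prod>i\<leftarrow>ks. u - Z i n)) / (2 * of_real pi * \<i>))
      \<longlongrightarrow> exp_dd_complex (map z ks)) F"
    using zR lim'' by (subst eq) (auto intro!: tendsto_intros)
  then show ?thesis
    by (rule Lim_transform_eventually) (use ZR in \<open>auto elim!: eventually_mono simp: eq\<close>)
qed simp

lemma tendsto_exp_dd:
  fixes X :: "'i \<Rightarrow> 'n \<Rightarrow> real"
  assumes "\<And>i. i \<in> set ks \<Longrightarrow> (X i \<longlongrightarrow> x i) F"
  shows "((\<lambda>n. exp_dd (map (\<lambda>i. X i n) ks)) \<longlongrightarrow> exp_dd (map x ks)) F"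
  using tendsto_Re[OF tendsto_exp_dd_complex[of "ks" "\<lambda>i n. of_real (X i n)" "\<lambda>i. of_real (x i)" F]] assms
  by (simp add: exp_dd_def o_def tendsto_of_real)

end

theory Submission
  imports Defs
begin

text \<open>
  The expression is a quadratic form in \<open>e\<^sup>a, e\<^sup>b, e\<^sup>c, e\<^sup>d\<close> without square terms. With
  \<open>w = (a + d - b - c) / 2\<close>, \<open>p = (a + b - c - d) / 2\<close>, \<open>q = (a + c - b - d) / 2\<close> it equals
  \<open>4 e\<^bsup>(a + b + c + d) / 2\<^esup>\<close> times the divided difference of \<open>\<phi>\<close> at the nodes
  \<open>w\<^sup>2, w\<^sup>2, p\<^sup>2, q\<^sup>2\<close>, where \<open>\<phi> (x\<^sup>2) = x sinh x - cosh x\<close>. The power series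
  of \<open>\<phi>\<close> has nonnegative coefficients apart from the constant one, so its third order divided
  differences at nonnegative nodes are nonnegative. Repeated nodes follow by continuity.
\<close>

section \<open>Coefficients and the quadratic form in the exponentials\<close>

text \<open>Coefficients of the exponentials in the divided differences with four simple nodes
  (\<open>simple_coeff\<close>) and with one double node (\<open>double_coeff\<close> at the double node, \<open>single_coeff\<close>
  at a simple one, the double node being its second argument).\<close>

definition simple_coeff :: "real \<Rightarrow> real \<Rightarrow> real \<Rightarrow> real \<Rightarrow> real" where
  "simple_coeff a b c d = 1 / ((a - b) * (a - c) * (a - d))"

definition double_coeff :: "real \<Rightarrow> real \<Rightarrow> real \<Rightarrow> real" where
  "double_coeff a b c = ((a - b) * (a - c) - (a - b) - (a - c)) / ((a - b)\<^sup>2 * (a - c)\<^sup>2)"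

definition single_coeff :: "real \<Rightarrow> real \<Rightarrow> real \<Rightarrow> real" where
  "single_coeff b a c = 1 / ((b - a)\<^sup>2 * (b - c))"

lemma double_coeff_commute: "double_coeff a b c = double_coeff a c b"
  by (simp add: double_coeff_def algebra_simps)

lemma simple_coeff_commute:
  "simple_coeff a b c d = simple_coeff a c b d" "simple_coeff a b c d = simple_coeff a b d c"
  by (simp_all add: simple_coeff_def mult_ac)

text \<open>This makes the square terms of the quadratic form vanish.\<close>

lemma single_coeff_mult: "single_coeff b a c * single_coeff b d c = (simple_coeff b a c d)\<^sup>2"
  by (simp add: single_coeff_def simple_coeff_def power2_eq_square mult_ac)

text \<open>The left side is the coefficient of \<open>exp a * exp b\<close> in the expression.
  Adjacency refers to the cycle \<open>a, b, d, c\<close>.\<close>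

lemma adjacent_coeff:
  assumes "distinct [a, b, c, d]"
  shows "double_coeff a b c * single_coeff b d c + double_coeff b a d * single_coeff a c d
      - 2 * (simple_coeff a b c d * simple_coeff b a c d)
    = (a + b - c - d - 2) / (((a - c) * (b - d))\<^sup>2 * ((a - d) * (b - c)))"
  using assms unfolding double_coeff_def single_coeff_def simple_coeff_def
  by (simp add: divide_simps) (simp add: algebra_simps power2_eq_square)

text \<open>The left side is the coefficient of \<open>exp a * exp d\<close>. All of it except the
  product of the double coefficients is minus a square, in which the factor \<open>a - d\<close>
  cancels.\<close>

lemma opposite_coeff:
  assumes "distinct [a, b, c, d]"
  shows "double_coeff a b c * double_coeff d b c + single_coeff a b d * single_coeff d c a
      + single_coeff a c d * single_coeff d b a - 2 * (simple_coeff a b c d * simple_coeff d a b c)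
    = (((a - b) * (a - c) - (a - b) - (a - c)) * ((d - b) * (d - c) - (d - b) - (d - c)) - (b - c)\<^sup>2)
      / ((a - b) * (a - c) * (d - b) * (d - c))\<^sup>2"
proof -
  have *: "simple_coeff d a b c = - (1 / ((a - d) * (d - b) * (d - c)))"
    "single_coeff d x a = - (1 / ((d - x)\<^sup>2 * (a - d)))" for x
    by (simp_all add: simple_coeff_def single_coeff_def minus_diff_eq[of a d, symmetric] del: minus_diff_eq)
  have "single_coeff a b d * single_coeff d c a + single_coeff a c d * single_coeff d b a
      - 2 * (simple_coeff a b c d * simple_coeff d a b c)
    = - ((1 / ((a - b) * (d - c)) - 1 / ((a - c) * (d - b))) / (a - d))\<^sup>2"
    \<comment> \<open>With the inverses as atoms this is a polynomial identity.\<close>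
    unfolding * unfolding single_coeff_def simple_coeff_def divide_inverse inverse_mult_distrib
      mult_1_left power_inverse[symmetric]
    by algebra
  also have "(1 / ((a - b) * (d - c)) - 1 / ((a - c) * (d - b))) / (a - d)
      = (c - b) / ((a - b) * (a - c) * (d - b) * (d - c))"
    using assms by (simp add: divide_simps) (simp add: algebra_simps)
  finally have "single_coeff a b d * single_coeff d c a + single_coeff a c d * single_coeff d b a
      - 2 * (simple_coeff a b c d * simple_coeff d a b c)
    = - ((b - c)\<^sup>2 / ((a - b) * (a - c) * (d - b) * (d - c))\<^sup>2)"
    unfolding power_divide power2_commute[of c b] .
  moreover have "double_coeff a b c * double_coeff d b c
      = ((a - b) * (a - c) - (a - b) - (a - c)) * ((d - b) * (d - c) - (d - b) - (d - c))
        / ((a - b) * (a - c) * (d - b) * (d - c))\<^sup>2"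
    by (simp add: double_coeff_def power_mult_distrib mult_ac)
  moreover have "r + s + t - u = (m - n) / k" if "s + t - u = - (n / k)" "r = m / k" for k m n r s t u :: real
    using that by (simp add: diff_divide_distrib)
  ultimately show ?thesis
    by metis
qed

text \<open>For \<open>A = exp a\<close> and so on, the numerators become multiples of
  \<open>\<phi>\<close> at \<open>p\<close>, \<open>q\<close>, \<open>w\<close> and of
  \<open>cosh w\<close>, so the right side takes the shape of
  \<open>confluent_divided_difference_eq\<close> at the nodes \<open>w\<^sup>2\<close>,
  \<open>p\<^sup>2\<close>, \<open>q\<^sup>2\<close>.\<close>

lemma quadratic_form_eq:
  fixes A B C D :: real
  assumes "distinct [a, b, c, d]"
  defines "w \<equiv> (a + d - b - c) / 2" and "p \<equiv> (a + b - c - d) / 2" and "q \<equiv> (a + c - b - d) / 2"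
  shows "(A * double_coeff a b c + B * single_coeff b a c + C * single_coeff c a b)
      * (D * double_coeff d b c + B * single_coeff b d c + C * single_coeff c d b)
    + (B * double_coeff b a d + A * single_coeff a b d + D * single_coeff d b a)
      * (C * double_coeff c a d + A * single_coeff a c d + D * single_coeff d c a)
    - (A * simple_coeff a b c d + B * simple_coeff b a c d + C * simple_coeff c a b d + D * simple_coeff d a b c)\<^sup>2
    = 2 * ((p * (A * B - C * D) - (A * B + C * D)) / ((p\<^sup>2 - w\<^sup>2)\<^sup>2 * (p\<^sup>2 - q\<^sup>2))
         - (q * (A * C - B * D) - (A * C + B * D)) / ((q\<^sup>2 - w\<^sup>2)\<^sup>2 * (p\<^sup>2 - q\<^sup>2))
         + (A * D + B * C) / 2 / ((p\<^sup>2 - w\<^sup>2) * (q\<^sup>2 - w\<^sup>2))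
         - (w * (A * D - B * C) - (A * D + B * C)) * (2 * w\<^sup>2 - p\<^sup>2 - q\<^sup>2) / ((p\<^sup>2 - w\<^sup>2) * (q\<^sup>2 - w\<^sup>2))\<^sup>2)"
    (is "?l = _")
proof -
  note d = double_coeff_commute simple_coeff_commute
  \<comment> \<open>Up to sign, each node difference is a sum or difference of two of
    \<open>w\<close>, \<open>p\<close>, \<open>q\<close>; differences of complementary pairs
    multiply to differences of squares.\<close>
  have nodes: "a - b = w + q" "b - a = - (w + q)" "a - c = w + p" "c - a = - (w + p)"
    "b - d = p - w" "d - b = w - p" "c - d = q - w" "d - c = w - q"
    "a - d = p + q" "d - a = - (p + q)" "b - c = p - q" "c - b = - (p - q)"
    by (simp_all add: w_def p_def q_def field_simps)
  have nodes_mult: "(a - c) * (b - d) = p\<^sup>2 - w\<^sup>2" "(d - b) * (c - a) = p\<^sup>2 - w\<^sup>2"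
    "(a - b) * (c - d) = q\<^sup>2 - w\<^sup>2" "(d - c) * (b - a) = q\<^sup>2 - w\<^sup>2"
    "(a - d) * (b - c) = p\<^sup>2 - q\<^sup>2" "(d - a) * (c - b) = p\<^sup>2 - q\<^sup>2"
    "(a - d) * (c - b) = - (p\<^sup>2 - q\<^sup>2)" "(d - a) * (b - c) = - (p\<^sup>2 - q\<^sup>2)"
    unfolding nodes by (simp_all add: power2_eq_square algebra_simps)
  have nodes_sum: "a + b - c - d = 2 * p" "d + c - b - a = - 2 * p"
    "a + c - b - d = 2 * q" "d + b - c - a = - 2 * q"
    by (simp_all add: p_def q_def)
  \<comment> \<open>Separates the later derivative term, with simple denominator, from the term with
    squared denominator.\<close>
  have split: "(x - y) / x\<^sup>2 = 1 / x - y / x\<^sup>2" for x y :: real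
    by (cases "x = 0") (simp_all add: diff_divide_distrib power2_eq_square)
  \<comment> \<open>\<open>cAB\<close> is the coefficient of \<open>A * B\<close>, and likewise for
    the other five.\<close>
  define cAB where "cAB = double_coeff a b c * single_coeff b d c + double_coeff b a d * single_coeff a c d
    - 2 * (simple_coeff a b c d * simple_coeff b a c d)"
  define cCD where "cCD = double_coeff d b c * single_coeff c a b + double_coeff c a d * single_coeff d b a
    - 2 * (simple_coeff d a b c * simple_coeff c a b d)"
  define cAC where "cAC = double_coeff a b c * single_coeff c d b + double_coeff c a d * single_coeff a b d
    - 2 * (simple_coeff a b c d * simple_coeff c a b d)"
  define cBD where "cBD = double_coeff d b c * single_coeff b a c + double_coeff b a d * single_coeff d c a
    - 2 * (simple_coeff d a b c * simple_coeff b a c d)"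
  define cAD where "cAD = double_coeff a b c * double_coeff d b c + single_coeff a b d * single_coeff d c a
      + single_coeff a c d * single_coeff d b a - 2 * (simple_coeff a b c d * simple_coeff d a b c)"
  define cBC where "cBC = double_coeff b a d * double_coeff c a d + single_coeff b a c * single_coeff c d b
      + single_coeff b d c * single_coeff c a b - 2 * (simple_coeff b a c d * simple_coeff c a b d)"
  \<comment> \<open>With the coefficients as independent variables the expansion is a plain
    polynomial identity.\<close>
  have expand: "(A * a1 + B * b1 + C * c1) * (D * d1 + B * b2 + C * c2)
    + (B * b3 + A * a2 + D * d2) * (C * c3 + A * a3 + D * d3)
    - (A * a4 + B * b4 + C * c4 + D * d4)\<^sup>2
    = A * B * (a1 * b2 + b3 * a3 - 2 * (a4 * b4)) + C * D * (d1 * c1 + c3 * d2 - 2 * (d4 * c4))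
    + A * C * (a1 * c2 + c3 * a2 - 2 * (a4 * c4)) + B * D * (d1 * b1 + b3 * d3 - 2 * (d4 * b4))
    + A * D * (a1 * d1 + a2 * d3 + a3 * d2 - 2 * (a4 * d4)) + B * C * (b3 * c3 + b1 * c2 + b2 * c1 - 2 * (b4 * c4))
    + A\<^sup>2 * (a2 * a3 - a4\<^sup>2) + B\<^sup>2 * (b1 * b2 - b4\<^sup>2) + C\<^sup>2 * (c1 * c2 - c4\<^sup>2) + D\<^sup>2 * (d2 * d3 - d4\<^sup>2)"
    for a1 a2 a3 a4 b1 b2 b3 b4 c1 c2 c3 c4 d1 d2 d3 d4
    by (simp add: algebra_simps power2_eq_square)
  have "?l = A * B * cAB + C * D * cCD + A * C * cAC + B * D * cBD + A * D * cAD + B * C * cBC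
    + A\<^sup>2 * (single_coeff a b d * single_coeff a c d - (simple_coeff a b c d)\<^sup>2)
    + B\<^sup>2 * (single_coeff b a c * single_coeff b d c - (simple_coeff b a c d)\<^sup>2)
    + C\<^sup>2 * (single_coeff c a b * single_coeff c d b - (simple_coeff c a b d)\<^sup>2)
    + D\<^sup>2 * (single_coeff d b a * single_coeff d c a - (simple_coeff d a b c)\<^sup>2)"
    unfolding cAB_def cCD_def cAC_def cBD_def cAD_def cBC_def by (rule expand)
  also have "\<dots> = A * B * cAB + C * D * cCD + A * C * cAC + B * D * cBD + A * D * cAD + B * C * cBC"
    by (simp add: single_coeff_mult d)
  also have "cAB = (2 * p - 2) / ((p\<^sup>2 - w\<^sup>2)\<^sup>2 * (p\<^sup>2 - q\<^sup>2))"
    using adjacent_coeff[of a b c d] assms(1) unfolding cAB_def nodes_mult nodes_sum by simp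
  \<comment> \<open>The other adjacent pairs come from permuted nodes: reversing
    \<open>a, b, c, d\<close> negates \<open>p\<close> and \<open>q\<close>, swapping
    \<open>b\<close> and \<open>c\<close> swaps \<open>p\<close> and \<open>q\<close>.\<close>
  also have "cCD = (- 2 * p - 2) / ((p\<^sup>2 - w\<^sup>2)\<^sup>2 * (p\<^sup>2 - q\<^sup>2))"
    using adjacent_coeff[of d c b a] assms(1) unfolding cCD_def nodes_mult nodes_sum by (auto simp: d)
  also have "cAC = (2 * q - 2) / ((q\<^sup>2 - w\<^sup>2)\<^sup>2 * - (p\<^sup>2 - q\<^sup>2))"
    using adjacent_coeff[of a c b d] assms(1) unfolding cAC_def nodes_mult nodes_sum by (auto simp: d)
  also have "cBD = (- 2 * q - 2) / ((q\<^sup>2 - w\<^sup>2)\<^sup>2 * - (p\<^sup>2 - q\<^sup>2))"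
    using adjacent_coeff[of d b c a] assms(1) unfolding cBD_def nodes_mult nodes_sum by (auto simp: d)
  also have "cAD = 1 / ((p\<^sup>2 - w\<^sup>2) * (q\<^sup>2 - w\<^sup>2))
      - 2 * (w - 1) * (2 * w\<^sup>2 - p\<^sup>2 - q\<^sup>2) / ((p\<^sup>2 - w\<^sup>2) * (q\<^sup>2 - w\<^sup>2))\<^sup>2"
  proof -
    have "((a - b) * (a - c) - (a - b) - (a - c)) * ((d - b) * (d - c) - (d - b) - (d - c)) - (b - c)\<^sup>2
        = (p\<^sup>2 - w\<^sup>2) * (q\<^sup>2 - w\<^sup>2) - 2 * (w - 1) * (2 * w\<^sup>2 - p\<^sup>2 - q\<^sup>2)"
      "(a - b) * (a - c) * (d - b) * (d - c) = (p\<^sup>2 - w\<^sup>2) * (q\<^sup>2 - w\<^sup>2)"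
      unfolding nodes by algebra+
    then show ?thesis
      using opposite_coeff[of a b c d] assms(1) by (simp only: cAD_def split)
  qed
  \<comment> \<open>Swapping \<open>a\<close> with \<open>b\<close> and \<open>c\<close> with
    \<open>d\<close> negates \<open>w\<close> and preserves \<open>p\<^sup>2\<close> and
    \<open>q\<^sup>2\<close>.\<close>
  also have "cBC = 1 / ((p\<^sup>2 - w\<^sup>2) * (q\<^sup>2 - w\<^sup>2))
      - 2 * (- w - 1) * (2 * w\<^sup>2 - p\<^sup>2 - q\<^sup>2) / ((p\<^sup>2 - w\<^sup>2) * (q\<^sup>2 - w\<^sup>2))\<^sup>2"
  proof -
    have "((b - a) * (b - d) - (b - a) - (b - d)) * ((c - a) * (c - d) - (c - a) - (c - d)) - (a - d)\<^sup>2
        = (p\<^sup>2 - w\<^sup>2) * (q\<^sup>2 - w\<^sup>2) - 2 * (- w - 1) * (2 * w\<^sup>2 - p\<^sup>2 - q\<^sup>2)"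
      "(b - a) * (b - d) * (c - a) * (c - d) = (p\<^sup>2 - w\<^sup>2) * (q\<^sup>2 - w\<^sup>2)"
      unfolding nodes by algebra+
    moreover have "distinct [b, a, d, c]"
      using assms(1) by auto
    ultimately show ?thesis
      using opposite_coeff[of b a d c] by (simp only: cBC_def split simple_coeff_commute(2)[of b a d c] simple_coeff_commute(1)[of c b a d])
  qed
  also
  note l_eq = calculation
  \<comment> \<open>Here \<open>i\<close>, \<open>j\<close>, \<open>k\<close>, \<open>l\<close>
    stand for the inverted denominators and \<open>n\<close> for
    \<open>2 * w\<^sup>2 - p\<^sup>2 - q\<^sup>2\<close>.\<close>
  have "A * B * ((2 * p - 2) * i) + C * D * ((- 2 * p - 2) * i)
      + A * C * ((2 * q - 2) * - j) + B * D * ((- 2 * q - 2) * - j)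
      + A * D * (k - 2 * (w - 1) * n * l) + B * C * (k - 2 * (- w - 1) * n * l)
    = 2 * ((p * (A * B - C * D) - (A * B + C * D)) * i - (q * (A * C - B * D) - (A * C + B * D)) * j
        + (A * D + B * C) * inverse 2 * k - (w * (A * D - B * C) - (A * D + B * C)) * n * l)"
    for i j k l n
    by (simp add: algebra_simps)
  then show ?thesis
    unfolding l_eq divide_inverse mult_minus_right inverse_minus_eq mult_1_left .
qed

section \<open>Divided differences with a double node\<close>

lemma exp_dd_double_node:
  assumes "distinct [a, b, c]"
  shows "exp_dd [a, a, b, c] =
    exp a * double_coeff a b c + exp b * single_coeff b a c + exp c * single_coeff c a b"
    (is "_ = ?r")
proof -
  \<comment> \<open>\<open>G\<close> is the explicit sum for the nodes \<open>x, b, c\<close>. Its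
    difference quotient between \<open>a\<close> and \<open>x\<close> is
    \<open>exp_dd [a, x, b, c]\<close>, so letting \<open>x\<close> tend to \<open>a\<close> yields
    the derivative of \<open>G\<close> at \<open>a\<close>.\<close>
  define G where "G x = exp x / ((x - b) * (x - c)) + exp b / ((b - x) * (b - c)) + exp c / ((c - x) * (c - b))" for x :: real
  have "((\<lambda>x. exp x / ((x - b) * (x - c))) has_real_derivative
      exp a * ((a - b) * (a - c) - (a - b) - (a - c)) / ((a - b)\<^sup>2 * (a - c)\<^sup>2)) (at a)"
    using assms by (auto intro!: derivative_eq_intros simp: power2_eq_square)
      (simp add: divide_simps, simp add: algebra_simps)
  moreover have "((\<lambda>x. k / ((y - x) * r)) has_real_derivative k / ((y - a)\<^sup>2 * r)) (at a)"
    if "y \<noteq> a" "r \<noteq> 0" for y k r :: real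
    using that by (auto intro!: derivative_eq_intros simp: power2_eq_square)
  ultimately have G: "(G has_real_derivative ?r) (at a)"
    unfolding G_def double_coeff_def single_coeff_def times_divide_eq_right mult_1_right
    using assms by (intro DERIV_add) auto
  have "\<forall>\<^sub>F x in at a. x \<in> - {b, c} - {a}"
    using assms by (intro eventually_at_in_open open_Compl finite_imp_closed) auto
  then have "\<forall>\<^sub>F x in at a. (G x - G a) / (x - a) = exp_dd [a, x, b, c]"
  proof eventually_elim
    case (elim x)
    then have "distinct [a, x, b, c]"
      using assms by auto
    moreover from this have "{a, x, b, c} - {a} = {x, b, c}" "{a, x, b, c} - {x} = {a, b, c}"
      "{a, x, b, c} - {b} = {a, x, c}" "{a, x, b, c} - {c} = {a, x, b}"
      by auto
    ultimately have "exp_dd [a, x, b, c] = exp a / ((a - x) * (a - b) * (a - c)) + exp x / ((x - a) * (x - b) * (x - c))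
      + exp b / ((b - a) * (b - x) * (b - c)) + exp c / ((c - a) * (c - x) * (c - b))"
      by (subst exp_dd_distinct) (auto simp: mult.assoc)
    \<comment> \<open>\<open>quot\<close> handles the summands belonging to the fixed nodes
      \<open>b\<close> and \<open>c\<close>.\<close>
    moreover have quot: "(k / ((y - x) * r) - k / ((y - a) * r)) / (x - a) = k / ((y - a) * (y - x) * r)"
      if "y \<noteq> a" "y \<noteq> x" "r \<noteq> 0" for y k r :: real
      using that elim by (simp add: divide_simps) (simp add: algebra_simps)
    have "(exp b / ((b - x) * (b - c)) - exp b / ((b - a) * (b - c))) / (x - a) = exp b / ((b - a) * (b - x) * (b - c))"
      "(exp c / ((c - x) * (c - b)) - exp c / ((c - a) * (c - b))) / (x - a) = exp c / ((c - a) * (c - x) * (c - b))"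
      using elim assms by (auto intro!: quot)
    moreover have "(exp x / ((x - b) * (x - c)) - exp a / ((a - b) * (a - c))) / (x - a)
        = exp a / ((a - x) * (a - b) * (a - c)) + exp x / ((x - a) * (x - b) * (x - c))"
      using elim assms by (simp add: divide_simps) (simp add: algebra_simps)
    moreover have "(r + s + t - (r' + s' + t')) / (x - a) = (r - r') / (x - a) + (s - s') / (x - a) + (t - t') / (x - a)"
      for r s t r' s' t'
      by (simp add: add_divide_distrib diff_divide_distrib)
    ultimately show ?case
      by (simp only: G_def)
  qed
  moreover have "((\<lambda>x. (G x - G a) / (x - a)) \<longlongrightarrow> ?r) (at a)"
    using G by (simp add: has_field_derivative_iff)
  ultimately have "((\<lambda>x. exp_dd [a, x, b, c]) \<longlongrightarrow> ?r) (at a)"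
    by (rule Lim_transform_eventually[rotated])
  moreover have "((\<lambda>x. exp_dd [a, x, b, c]) \<longlongrightarrow> exp_dd [a, a, b, c]) (at a)"
  proof -
    have "((\<lambda>x. exp_dd (map (\<lambda>i. [a, x, b, c] ! i) [0, 1, 2, 3])) \<longlongrightarrow>
        exp_dd (map (\<lambda>i. [a, a, b, c] ! i) [0, 1, 2, 3])) (at a)"
      by (rule tendsto_exp_dd) (auto simp: numeral_eq_Suc)
    then show ?thesis
      by (simp add: numeral_eq_Suc)
  qed
  ultimately show ?thesis
    using tendsto_unique trivial_limit_at by blast
qed

section \<open>Taylor remainders of power series\<close>

text \<open>The function \<open>m k y\<close> in the proof below is \<open>(y\<^sup>k - x\<^sup>k - k x\<^bsup>k-1\<^esup> (y - x)) / (y - x)\<^sup>2\<close>, a polynomial in \<open>y\<close>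
  with nonnegative coefficients.\<close>

lemma power_series_remainder_mono:
  fixes x y z :: real and c :: "nat \<Rightarrow> real"
  assumes c: "\<And>k. k \<ge> 1 \<Longrightarrow> c k \<ge> 0"
    and x: "x \<ge> 0" and z: "0 \<le> z" and zy: "z \<le> y" and ne: "y \<noteq> x" "z \<noteq> x"
    and fx: "(\<lambda>k. c k * x ^ k) sums fx" and fy: "(\<lambda>k. c k * y ^ k) sums fy" and fz: "(\<lambda>k. c k * z ^ k) sums fz"
    and f'x: "(\<lambda>k. c k * (of_nat k * x ^ (k - 1))) sums f'x"
  shows "(fz - fx - f'x * (z - x)) / (z - x)\<^sup>2 \<le> (fy - fx - f'x * (y - x)) / (y - x)\<^sup>2"
proof -
  define m where "m = rec_nat (\<lambda>y::real. 0::real) (\<lambda>k r y. y * r y + of_nat k * x ^ (k - 1))"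
  have m_0: "m 0 y = 0" and m_Suc: "m (Suc k) y = y * m k y + of_nat k * x ^ (k - 1)" for k y
    by (simp_all add: m_def)
  \<comment> \<open>The recursion for \<open>m\<close> reflects that the remainder of
    \<open>y ^ Suc k\<close> is \<open>y\<close> times that of \<open>y ^ k\<close> plus
    \<open>k * x ^ (k - 1) * (y - x)\<^sup>2\<close>.\<close>
  have m_eq: "m k y * (y - x)\<^sup>2 = y ^ k - x ^ k - of_nat k * x ^ (k - 1) * (y - x)" for k y
  proof (induction k)
    case (Suc k)
    then show ?case
      unfolding m_Suc distrib_right mult.assoc Suc.IH
      by (cases k) (simp_all add: algebra_simps power2_eq_square)
  qed (simp add: m_0)
  have m_nonneg: "m k y \<ge> 0" if "y \<ge> 0" for k y
    by (induction k) (use that x in \<open>auto simp: m_0 m_Suc\<close>)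
  have m_mono: "m k z \<le> m k y" for k
    by (induction k) (use z zy m_nonneg in \<open>auto simp: m_0 m_Suc intro!: mult_mono\<close>)
  have sums: "(\<lambda>k. c k * m k y) sums ((fy - fx - f'x * (y - x)) / (y - x)\<^sup>2)"
    if "(\<lambda>k. c k * y ^ k) sums fy" "y \<noteq> x" for y fy
  proof -
    have "(\<lambda>k. (c k * y ^ k - c k * x ^ k - c k * (of_nat k * x ^ (k - 1)) * (y - x)) / (y - x)\<^sup>2) sums
        ((fy - fx - f'x * (y - x)) / (y - x)\<^sup>2)"
      by (intro sums_divide sums_diff sums_mult2 that fx f'x)
    moreover have "(c k * y ^ k - c k * x ^ k - c k * (of_nat k * x ^ (k - 1)) * (y - x)) / (y - x)\<^sup>2 = c k * m k y" for k
    proof -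
      have "c k * y ^ k - c k * x ^ k - c k * (of_nat k * x ^ (k - 1)) * (y - x) = c k * (m k y * (y - x)\<^sup>2)"
        by (simp add: m_eq algebra_simps)
      then show ?thesis
        using that(2) by simp
    qed
    ultimately show ?thesis
      by simp
  qed
  show ?thesis
  proof (rule sums_le[OF _ sums[OF fz ne(2)] sums[OF fy ne(1)]])
    \<comment> \<open>Since \<open>m 0\<close> is zero, a negative \<open>c 0\<close> does no
      harm.\<close>
    show "c k * m k z \<le> c k * m k y" for k
      using m_mono[of k] c[of k] by (cases k) (auto simp: m_0 intro: mult_left_mono)
  qed
qed

section \<open>The function \<open>\<phi>\<close> and its divided differences\<close>

lemma cosh_sums_even: "(\<lambda>k. (x\<^sup>2) ^ k / fact (2 * k)) sums cosh x"
  for x :: real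
proof -
  have "(\<lambda>k. if even (2 * k) then x ^ (2 * k) /\<^sub>R fact (2 * k) else 0) sums cosh x"
    using cosh_converges[of x]
    by (subst sums_mono_reindex[of "\<lambda>k. 2 * k"]) (auto simp: strict_mono_def)
  then show ?thesis
    by (simp add: power_mult divide_inverse mult.commute[of "inverse _"])
qed

text \<open>The coefficient \<open>1 / (2 k - 1)!\<close> is written as \<open>2 k / (2 k)!\<close>,
  which covers \<open>k = 0\<close> and shares its denominator with the cosh series.\<close>

lemma sinh_sums_even: "(\<lambda>k. 2 * of_nat k * (x\<^sup>2) ^ k / fact (2 * k)) sums (x * sinh x)"
  for x :: real
proof -
  let ?f = "\<lambda>n. if even n then of_nat n * x ^ n / fact n else 0"
  have "x * (if even n then 0 else x ^ n /\<^sub>R fact n) = ?f (Suc n)" for n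
  proof -
    have "of_nat (Suc n) * x ^ Suc n / fact (Suc n) = x * (x ^ n / fact n)"
      unfolding fact_Suc power_Suc by (simp del: of_nat_Suc)
    then show ?thesis
      by (simp add: divide_inverse mult.commute[of "inverse (fact n)"] del: of_nat_Suc fact_Suc power_Suc)
  qed
  then have "(\<lambda>n. ?f (Suc n)) sums (x * sinh x)"
    using sums_mult[OF sinh_converges[of x], of x] by simp
  then have "?f sums (x * sinh x)"
    by (subst (asm) sums_Suc_iff) simp
  then have "(\<lambda>k. ?f (2 * k)) sums (x * sinh x)"
    by (subst sums_mono_reindex[of "\<lambda>k. 2 * k"]) (auto simp: strict_mono_def)
  then show ?thesis
    by (simp add: power_mult)
qed

text \<open>As a power series in \<open>x\<^sup>2\<close>, \<open>\<phi>\<close> has the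
  coefficients \<open>(2 k - 1) / (2 k)!\<close>, negative only at \<open>k = 0\<close>, and
  \<open>cosh w / 2\<close> is its derivative with respect to \<open>x\<^sup>2\<close> at
  \<open>w\<^sup>2\<close>.\<close>

lemma remainder_mono:
  fixes w p q :: real
  defines "\<phi> \<equiv> \<lambda>x. x * sinh x - cosh x"
  assumes "p\<^sup>2 \<noteq> w\<^sup>2" "q\<^sup>2 \<noteq> w\<^sup>2" "q\<^sup>2 \<le> p\<^sup>2"
  shows "(\<phi> q - \<phi> w - cosh w / 2 * (q\<^sup>2 - w\<^sup>2)) / (q\<^sup>2 - w\<^sup>2)\<^sup>2
    \<le> (\<phi> p - \<phi> w - cosh w / 2 * (p\<^sup>2 - w\<^sup>2)) / (p\<^sup>2 - w\<^sup>2)\<^sup>2"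
proof -
  define c where "c k = (2 * real k - 1) / fact (2 * k)" for k
  have \<phi>: "(\<lambda>k. c k * (x\<^sup>2) ^ k) sums \<phi> x" for x
    using sums_diff[OF sinh_sums_even[of x] cosh_sums_even[of x]]
    by (simp add: c_def \<phi>_def diff_divide_distrib left_diff_distrib)
  \<comment> \<open>Termwise differentiation gives half the cosh series, as
    \<open>(k + 1) (2 k + 1) / (2 k + 2)! = 1 / (2 (2 k)!)\<close>.\<close>
  have "c (Suc k) * (of_nat (Suc k) * (w\<^sup>2) ^ (Suc k - 1)) = (w\<^sup>2) ^ k / fact (2 * k) / 2" for k
  proof -
    have "fact (2 * Suc k) = 2 * (real k + 1) * (2 * real k + 1) * fact (2 * k)"
      by (simp add: algebra_simps)
    then show ?thesis
      by (simp add: c_def divide_simps add_nonneg_eq_0_iff del: mult_Suc_right fact_Suc) (simp add: algebra_simps)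
  qed
  then have "(\<lambda>k. c (Suc k) * (of_nat (Suc k) * (w\<^sup>2) ^ (Suc k - 1))) sums (cosh w / 2)"
    using sums_divide[OF cosh_sums_even[of w], of 2] by simp
  then have \<phi>': "(\<lambda>k. c k * (of_nat k * (w\<^sup>2) ^ (k - 1))) sums (cosh w / 2)"
    by (subst (asm) sums_Suc_iff) simp
  show ?thesis
    by (rule power_series_remainder_mono[of c]) (use assms \<phi> \<phi>' in \<open>auto simp: c_def\<close>)
qed

text \<open>Two forms of \<open>f[x, x, y, z]\<close>: the difference quotient of
  \<open>t \<mapsto> f[x, x, t]\<close> between \<open>z\<close> and \<open>y\<close>, and its
  expansion in the values and the derivative of \<open>f\<close>.\<close>

lemma confluent_divided_difference_eq:
  fixes x y z :: real
  assumes "x \<noteq> y" "x \<noteq> z" "y \<noteq> z"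
  shows "((fy - fx - f'x * (y - x)) / (y - x)\<^sup>2 - (fz - fx - f'x * (z - x)) / (z - x)\<^sup>2) / (y - z)
    = fy / ((y - x)\<^sup>2 * (y - z)) - fz / ((z - x)\<^sup>2 * (y - z)) + f'x / ((y - x) * (z - x))
      - fx * (2 * x - y - z) / ((y - x) * (z - x))\<^sup>2"
proof -
  have "(u - v - t * s) / s\<^sup>2 = u / s\<^sup>2 - v / s\<^sup>2 - t / s" if "s \<noteq> 0" for u v t s :: real
    using that by (simp add: diff_divide_distrib power2_eq_square)
  moreover have "(1 / (z - x)\<^sup>2 - 1 / (y - x)\<^sup>2) / (y - z) = - ((2 * x - y - z) / ((y - x) * (z - x))\<^sup>2)"
    "(1 / (z - x) - 1 / (y - x)) / (y - z) = 1 / ((y - x) * (z - x))"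
    using assms by (simp_all add: divide_simps) (simp_all add: algebra_simps power2_eq_square)
  moreover have "(fy / (y - x)\<^sup>2 - fx / (y - x)\<^sup>2 - f'x / (y - x)
        - (fz / (z - x)\<^sup>2 - fx / (z - x)\<^sup>2 - f'x / (z - x))) / (y - z)
      = fy / ((y - x)\<^sup>2 * (y - z)) - fz / ((z - x)\<^sup>2 * (y - z))
        + f'x * ((1 / (z - x) - 1 / (y - x)) / (y - z)) + fx * ((1 / (z - x)\<^sup>2 - 1 / (y - x)\<^sup>2) / (y - z))"
    by (simp add: diff_divide_distrib add_divide_distrib right_diff_distrib)
  ultimately show ?thesis
    using assms by simp
qed

section \<open>The inequality at distinct nodes\<close>

lemma exp_dd_ineq_distinct:
  assumes dist: "distinct [a, b, c, d]"
  shows "exp_dd [a, a, b, c] * exp_dd [d, d, b, c] + exp_dd [b, b, a, d] * exp_dd [c, c, a, d]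
    - (exp_dd [a, b, c, d])\<^sup>2 \<ge> 0"
proof -
  define w p q where "w = (a + d - b - c) / 2" and "p = (a + b - c - d) / 2" and "q = (a + c - b - d) / 2"
  define E where "E = exp ((a + b + c + d) / 2)"
  define \<phi> where "\<phi> x = x * sinh x - cosh x" for x :: real
  \<comment> \<open>\<open>\<theta> x\<close> is the divided difference of \<open>\<phi>\<close>, as
    a function of the square, at \<open>w\<^sup>2, w\<^sup>2, x\<^sup>2\<close>.\<close>
  define \<theta> where "\<theta> x = (\<phi> x - \<phi> w - cosh w / 2 * (x\<^sup>2 - w\<^sup>2)) / (x\<^sup>2 - w\<^sup>2)\<^sup>2" for x
  have "p\<^sup>2 - w\<^sup>2 = (a - c) * (b - d)" "q\<^sup>2 - w\<^sup>2 = (a - b) * (c - d)" "p\<^sup>2 - q\<^sup>2 = (a - d) * (b - c)"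
    by (simp_all add: w_def p_def q_def power2_eq_square field_simps)
  with dist have ne: "p\<^sup>2 \<noteq> w\<^sup>2" "q\<^sup>2 \<noteq> w\<^sup>2" "p\<^sup>2 \<noteq> q\<^sup>2"
    by auto
  have four: "exp_dd [a, b, c, d] = exp a * simple_coeff a b c d + exp b * simple_coeff b a c d
      + exp c * simple_coeff c a b d + exp d * simple_coeff d a b c"
  proof -
    have "{a, b, c, d} - {a} = {b, c, d}" "{a, b, c, d} - {b} = {a, c, d}"
      "{a, b, c, d} - {c} = {a, b, d}" "{a, b, c, d} - {d} = {a, b, c}"
      using dist by auto
    then show ?thesis
      using dist by (simp add: exp_dd_distinct simple_coeff_def mult.assoc)
  qed
  \<comment> \<open>For instance, \<open>a + b\<close> is the half sum of all four nodes plus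
    \<open>p\<close>, and \<open>c + d\<close> is the half sum minus \<open>p\<close>.\<close>
  have pairs: "exp a * exp b = E * exp p" "exp c * exp d = E * exp (- p)"
    "exp a * exp c = E * exp q" "exp b * exp d = E * exp (- q)"
    "exp a * exp d = E * exp w" "exp b * exp c = E * exp (- w)"
    by (simp_all add: E_def p_def q_def w_def field_simps flip: exp_add)
  have \<phi>: "x * (E * exp x - E * exp (- x)) - (E * exp x + E * exp (- x)) = 2 * E * \<phi> x"
    and cosh: "E * exp x + E * exp (- x) = 2 * E * cosh x" for x
    by (simp_all add: \<phi>_def cosh_field_def sinh_field_def field_simps)
  have scale: "2 * (2 * E * P / r - 2 * E * Q / s + 2 * E * R / 2 / t - 2 * E * S * T / u)
      = 4 * E * (P / r - Q / s + R / 2 / t - S * T / u)" for P Q R S T r s t u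
    by (simp add: algebra_simps)
  have "exp_dd [a, a, b, c] * exp_dd [d, d, b, c] + exp_dd [b, b, a, d] * exp_dd [c, c, a, d]
      - (exp_dd [a, b, c, d])\<^sup>2
    = (exp a * double_coeff a b c + exp b * single_coeff b a c + exp c * single_coeff c a b)
      * (exp d * double_coeff d b c + exp b * single_coeff b d c + exp c * single_coeff c d b)
    + (exp b * double_coeff b a d + exp a * single_coeff a b d + exp d * single_coeff d b a)
      * (exp c * double_coeff c a d + exp a * single_coeff a c d + exp d * single_coeff d c a)
    - (exp a * simple_coeff a b c d + exp b * simple_coeff b a c d
      + exp c * simple_coeff c a b d + exp d * simple_coeff d a b c)\<^sup>2"
    using dist by (subst (1 2 3 4) exp_dd_double_node) (auto simp: four)
  also have "\<dots> = 2 * (2 * E * \<phi> p / ((p\<^sup>2 - w\<^sup>2)\<^sup>2 * (p\<^sup>2 - q\<^sup>2)) - 2 * E * \<phi> q / ((q\<^sup>2 - w\<^sup>2)\<^sup>2 * (p\<^sup>2 - q\<^sup>2))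
      + 2 * E * cosh w / 2 / ((p\<^sup>2 - w\<^sup>2) * (q\<^sup>2 - w\<^sup>2))
      - 2 * E * \<phi> w * (2 * w\<^sup>2 - p\<^sup>2 - q\<^sup>2) / ((p\<^sup>2 - w\<^sup>2) * (q\<^sup>2 - w\<^sup>2))\<^sup>2)"
    unfolding quadratic_form_eq[OF dist, folded w_def p_def q_def] pairs \<phi>
    unfolding cosh ..
  also have "\<dots> = 4 * E * ((\<theta> p - \<theta> q) / (p\<^sup>2 - q\<^sup>2))"
    unfolding \<theta>_def confluent_divided_difference_eq[OF ne(1)[symmetric] ne(2)[symmetric] ne(3)]
    by (rule scale)
  also have "\<dots> \<ge> 0"
  proof -
    \<comment> \<open>As \<open>\<theta>\<close> increases with the square of its argument,
      \<open>\<theta> p - \<theta> q\<close> never has the sign opposite to that of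
      \<open>p\<^sup>2 - q\<^sup>2\<close>.\<close>
    have "\<theta> x \<le> \<theta> y" if "x\<^sup>2 \<le> y\<^sup>2" "x\<^sup>2 \<noteq> w\<^sup>2" "y\<^sup>2 \<noteq> w\<^sup>2" for x y
      using remainder_mono[of y w x] that by (simp add: \<theta>_def \<phi>_def)
    from this[of p q] this[of q p] ne have "(\<theta> p - \<theta> q) / (p\<^sup>2 - q\<^sup>2) \<ge> 0"
      by (cases "p\<^sup>2 \<le> q\<^sup>2") (auto intro: divide_nonpos_nonpos divide_nonneg_nonneg)
    then show ?thesis
      unfolding E_def by (intro mult_nonneg_nonneg) auto
  qed
  finally show ?thesis .
qed

section \<open>Repeated nodes by continuity\<close>

theorem theorem3:
  fixes a b c d :: real
  shows "exp_dd [a, a, b, c] * exp_dd [d, d, b, c] + exp_dd [b, b, a, d] * exp_dd [c, c, a, d]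
           - (exp_dd [a, b, c, d])\<^sup>2 \<ge> 0"
proof -
  \<comment> \<open>The nodes move at the distinct speeds 0, 1, 2, 3, so any two of them meet for
    exactly one \<open>t\<close>.\<close>
  define x where "x i t = [a, b, c, d] ! i + real i * t" for i t
  define F where "F t = exp_dd [x 0 t, x 0 t, x 1 t, x 2 t] * exp_dd [x 3 t, x 3 t, x 1 t, x 2 t]
    + exp_dd [x 1 t, x 1 t, x 0 t, x 3 t] * exp_dd [x 2 t, x 2 t, x 0 t, x 3 t]
    - (exp_dd [x 0 t, x 1 t, x 2 t, x 3 t])\<^sup>2" for t
  have x: "(x i \<longlongrightarrow> [a, b, c, d] ! i) (at 0)" for i
    unfolding x_def by (auto intro!: tendsto_eq_intros)
  have dd: "((\<lambda>t. exp_dd [x i t, x j t, x k t, x l t]) \<longlongrightarrow>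
      exp_dd (map ((!) [a, b, c, d]) [i, j, k, l])) (at 0)" for i j k l
    using tendsto_exp_dd[of "[i, j, k, l]" x "(!) [a, b, c, d]" "at 0"] x by simp
  have "(F \<longlongrightarrow> exp_dd [a, a, b, c] * exp_dd [d, d, b, c] + exp_dd [b, b, a, d] * exp_dd [c, c, a, d]
      - (exp_dd [a, b, c, d])\<^sup>2) (at 0)"
    unfolding F_def
    by (rule tendsto_eq_intros dd refl | simp add: numeral_eq_Suc)+
  moreover have "\<forall>\<^sub>F t in at 0. F t \<ge> 0"
  proof -
    have ev: "\<forall>\<^sub>F t in at 0. x i t \<noteq> x j t" if "i \<noteq> j" for i j
    proof -
      \<comment> \<open>The excluded value is the meeting time; should it be 0, the punctured
        neighbourhood omits it.\<close>
      have "\<forall>\<^sub>F t in at 0. t \<noteq> ([a, b, c, d] ! j - [a, b, c, d] ! i) / (real i - real j)"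
        by (rule eventually_neq_at_within)
      then show ?thesis
        by eventually_elim (use that in \<open>auto simp: x_def field_simps\<close>)
    qed
    have "\<forall>\<^sub>F t in at 0. distinct [x 0 t, x 1 t, x 2 t, x 3 t]"
      by (auto intro!: eventually_conj ev)
    then show ?thesis
      by eventually_elim (unfold F_def, rule exp_dd_ineq_distinct)
  qed
  ultimately show ?thesis
    by (rule tendsto_lowerbound) simp
qed

end
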